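(* Let $d\ge1$, let $\mathcal X\subset\mathbb R^d$ be non-empty and compact, let $\|\cdot\|$ be a norm on $\mathbb R^d$, let $L>0$, and let $\varepsilon_0:=L\max_{x,y\in\mathcal X}\|x-y\|$. Let nc.DOO be the algorithm described in the context, run with a hierarchy of cells and representatives satisfying conditions (D1) and (D2) of the context with constants $K$, $\delta$, $R$, $\nu$. Then, for all $f\in\mathcal F_L$ and all $\varepsilon\in(0,\varepsilon_0]$, the non-certified sample complexity of nc.DOO satisfies $$\zeta(\text{nc.DOO},f,\varepsilon)\le1+C_d\sum_{k=1}^{m_\varepsilon}\mathcal N\left(\mathcal X_{(\varepsilon_k,\varepsilon_{k-1}]},\frac{\varepsilon_k}{L}\right),$$ where $C_d=K\left(\mathbf 1_{\nu/R\ge1}+\mathbf 1_{\nu/R<1}(4R/\nu)^d\right)$, $m_\varepsilon:=\lceil\log_2(\varepsilon_0/\varepsilon)\rceil$, $\varepsilon_{m_\varepsilon}:=\varepsilon$, and $\varepsilon_k:=\varepsilon_02^{-k}$ for $0\le k\le m_\varepsilon-1$.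
   Context: For Lipschitz $g:\mathcal X\to\mathbb R$, $\mathrm{Lip}(g)$ is its smallest Lipschitz constant with respect to $\|\cdot\|$; $\mathcal F_L:=\{g:\mathcal X\to\mathbb R\mid g\text{ Lipschitz and }\mathrm{Lip}(g)<L\}$. For $0\le a<b$, $\mathcal X_{(a,b]}:=\{x\in\mathcal X:a<\max(f)-f(x)\le b\}$. For bounded $E\subset\mathbb R^d$ and $r>0$, the packing number is $\mathcal N(E,r):=\sup\{k\ge1:\exists x_1,\dots,x_k\in E,\ \min_{i\ne j}\|x_i-x_j\|>r\}$ if $E\neq\varnothing$, and $0$ if $E=\varnothing$. For an algorithm $A$ that, run on $f$, sequentially queries points $x_1,x_2,\dots\in\mathcal X$ and after each query $x_n$ outputs a recommendation $x_n^\star\in\mathcal X$, the non-certified sample complexity is $\zeta(A,f,\varepsilon):=\inf\{n\ge1:\max(f)-f(x_n^\star)\le\varepsilon\}\in\{1,2,\dots\}\cup\{+\infty\}$. Hierarchy of cells: fix $K\in\{1,2,\dots\}$ and subsets $X_{h,i}$ of $\mathbb R^d$ ($h\in\mathbb N=\{0,1,\dots\}$, $i=0,\dots,K^h-1$), called cells, such that for each $h$ the cells $X_{h,0},\dots,X_{h,K^h-1}$ are non-empty, pairwise disjoint, and their union contains $\mathcal X$; and for each $(h,j)$ there are $K$ distinct indices $i_1,\dots,i_K\in\{0,\dots,K^{h+1}-1\}$ such that $X_{h+1,i_1},\dots,X_{h+1,i_K}$ form a partition of $X_{h,j}$; $(h+1,i_1),\dots,(h+1,i_K)$ are called the children of $(h,j)$.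 Each cell has a representative $x_{h,i}\in X_{h,i}$, with $x_{h,i}\in\mathcal X$ whenever $X_{h,i}\cap\mathcal X\ne\varnothing$. Conditions: (D1) there are $\delta\in(0,1)$, $R>0$ with $\|u-v\|\le R\delta^h$ for all $h,i$ and all $u,v\in X_{h,i}$; (D2) there is $\nu>0$ with $\|x_{h,i}-x_{h',i'}\|\ge\nu\delta^{\max(h,h')}$ for all $(h,i)\ne(h',i')$. Algorithm nc.DOO (non-certified DOO): set $n=1$ and $\mathcal L=\{(0,0)\}$; query $x_1=x_{0,0}$, recommend $x_1^\star=x_1$. Then repeat for iterations $k=1,2,\dots$: choose $(h^\star,i^\star)\in\mathrm{argmax}_{(h,i)\in\mathcal L}\{f(x_{h,i})+LR\delta^h\}$ (ties broken arbitrarily); for each child $(h^\star+1,j)$ of $(h^\star,i^\star)$ in turn with $X_{h^\star+1,j}\cap\mathcal X\ne\varnothing$: increase $n$ by one, add $(h^\star+1,j)$ to $\mathcal L$, query $x_n=x_{h^\star+1,j}$, and output a recommendation $x_n^\star\in\mathrm{argmax}_{x\in\{x_1,\dots,x_n\}}f(x)$; after all children are processed, remove $(h^\star,i^\star)$ from $\mathcal L$. *)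

theory Defs
  imports "HOL-Analysis.Analysis" "HOL-Library.Disjoint_Sets"
begin

(* An arbitrary norm on R^d, passed as a function argument; the type class norm is the Euclidean
   one and is used only for topological notions such as compactness, on which all norms agree. *)
definition is_norm :: "(real ^ 'd \<Rightarrow> real) \<Rightarrow> bool" where
  "is_norm nrm \<longleftrightarrow>
     (\<forall>x. 0 \<le> nrm x) \<and> (\<forall>x. nrm x = 0 \<longleftrightarrow> x = 0) \<and>
     (\<forall>c x. nrm (c *\<^sub>R x) = \<bar>c\<bar> * nrm x) \<and> (\<forall>x y. nrm (x + y) \<le> nrm x + nrm y)"

(* Functions X -> R are represented by total functions; all notions below evaluate them only at
   points of X. *)
definition lip_bound :: "(real ^ 'd \<Rightarrow> real) \<Rightarrow> (real ^ 'd) set \<Rightarrow> (real ^ 'd \<Rightarrow> real) \<Rightarrow> real \<Rightarrow> bool" where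
  "lip_bound nrm X g c \<longleftrightarrow> 0 \<le> c \<and> (\<forall>x\<in>X. \<forall>y\<in>X. \<bar>g x - g y\<bar> \<le> c * nrm (x - y))"

definition lip_const :: "(real ^ 'd \<Rightarrow> real) \<Rightarrow> (real ^ 'd) set \<Rightarrow> (real ^ 'd \<Rightarrow> real) \<Rightarrow> real" where
  "lip_const nrm X g = Inf {c. lip_bound nrm X g c}"

definition lip_class :: "(real ^ 'd \<Rightarrow> real) \<Rightarrow> (real ^ 'd) set \<Rightarrow> real \<Rightarrow> (real ^ 'd \<Rightarrow> real) set" where
  "lip_class nrm X L = {g. (\<exists>c. lip_bound nrm X g c) \<and> lip_const nrm X g < L}"

(* The maximum of f over X; on the compact nonempty X the supremum of a Lipschitz f is attained. *)
definition max_on :: "(real ^ 'd) set \<Rightarrow> (real ^ 'd \<Rightarrow> real) \<Rightarrow> real" where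
  "max_on X f = (SUP x\<in>X. f x)"

definition layer :: "(real ^ 'd) set \<Rightarrow> (real ^ 'd \<Rightarrow> real) \<Rightarrow> real \<Rightarrow> real \<Rightarrow> (real ^ 'd) set" where
  "layer X f a b = {x \<in> X. a < max_on X f - f x \<and> max_on X f - f x \<le> b}"

(* For k = 1 the separation condition is void (minimum over the empty set is infinite), so every
   nonempty E has packing number at least 1. *)
definition packing_number :: "(real ^ 'd \<Rightarrow> real) \<Rightarrow> (real ^ 'd) set \<Rightarrow> real \<Rightarrow> enat" where
  "packing_number nrm E r =
     (if E = {} then 0
      else SUP k\<in>{k. 1 \<le> k \<and> (\<exists>x :: nat \<Rightarrow> real ^ 'd. (\<forall>i\<in>{1..k}. x i \<in> E) \<and>
             (\<forall>i\<in>{1..k}. \<forall>j\<in>{1..k}. i \<noteq> j \<longrightarrow> nrm (x i - x j) > r))}. enat k)"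

(* Run on f, an algorithm produces for each n >= 1 the n-th query and the n-th recommendation;
   index 0 is unused. *)
type_synonym 'd algorithm = "(real ^ 'd \<Rightarrow> real) \<Rightarrow> nat \<Rightarrow> (real ^ 'd) \<times> (real ^ 'd)"

(* The infimum of the empty set in enat is infinity. *)
definition sample_complexity ::
    "(real ^ 'd) set \<Rightarrow> 'd algorithm \<Rightarrow> (real ^ 'd \<Rightarrow> real) \<Rightarrow> real \<Rightarrow> enat" where
  "sample_complexity X A f \<epsilon> = (INF n\<in>{n. 1 \<le> n \<and> max_on X f - f (snd (A f n)) \<le> \<epsilon>}. enat n)"

(* J is the set of second indices of the children of the cell (h, j). *)
definition children :: "nat \<Rightarrow> (nat \<Rightarrow> nat \<Rightarrow> (real ^ 'd) set) \<Rightarrow> nat \<Rightarrow> nat \<Rightarrow> nat set \<Rightarrow> bool" where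
  "children K cell h j J \<longleftrightarrow>
     J \<subseteq> {..<K ^ Suc h} \<and> card J = K \<and> partition_on (cell h j) (cell (Suc h) ` J)"

definition cell_hierarchy ::
    "(real ^ 'd) set \<Rightarrow> nat \<Rightarrow> (nat \<Rightarrow> nat \<Rightarrow> (real ^ 'd) set) \<Rightarrow> (nat \<Rightarrow> nat \<Rightarrow> real ^ 'd) \<Rightarrow> bool" where
  "cell_hierarchy X K cell rep \<longleftrightarrow>
     1 \<le> K \<and>
     (\<forall>h. (\<forall>i<K ^ h. cell h i \<noteq> {}) \<and> disjoint_family_on (cell h) {..<K ^ h} \<and>
          X \<subseteq> (\<Union>i<K ^ h. cell h i)) \<and>
     (\<forall>h. \<forall>j<K ^ h. \<exists>J. children K cell h j J) \<and>
     (\<forall>h. \<forall>i<K ^ h. rep h i \<in> cell h i \<and> (cell h i \<inter> X \<noteq> {} \<longrightarrow> rep h i \<in> X))"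

definition cond_D1 ::
    "(real ^ 'd \<Rightarrow> real) \<Rightarrow> nat \<Rightarrow> (nat \<Rightarrow> nat \<Rightarrow> (real ^ 'd) set) \<Rightarrow> real \<Rightarrow> real \<Rightarrow> bool" where
  "cond_D1 nrm K cell \<delta> R \<longleftrightarrow>
     0 < \<delta> \<and> \<delta> < 1 \<and> 0 < R \<and>
     (\<forall>h. \<forall>i<K ^ h. \<forall>u\<in>cell h i. \<forall>v\<in>cell h i. nrm (u - v) \<le> R * \<delta> ^ h)"

definition cond_D2 ::
    "(real ^ 'd \<Rightarrow> real) \<Rightarrow> nat \<Rightarrow> (nat \<Rightarrow> nat \<Rightarrow> real ^ 'd) \<Rightarrow> real \<Rightarrow> real \<Rightarrow> bool" where
  "cond_D2 nrm K rep \<delta> \<nu> \<longleftrightarrow>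
     0 < \<nu> \<and>
     (\<forall>h h'. \<forall>i<K ^ h. \<forall>i'<K ^ h'. (h, i) \<noteq> (h', i') \<longrightarrow>
        nrm (rep h i - rep h' i') \<ge> \<nu> * \<delta> ^ max h h')"

(* x and xr are the queries and recommendations of some run of nc.DOO on f, with arbitrary
   tie-breaking and an arbitrary processing order of the children.  For each iteration k
   (counted from 0): act k is the set of active cells and N k the number of queries made when the
   iteration starts, (hs k, js k) is the selected cell, and ord k enumerates, in processing order,
   the second indices of those of its children that meet X. *)
definition nc_DOO_run ::
    "(real ^ 'd) set \<Rightarrow> real \<Rightarrow> nat \<Rightarrow> (nat \<Rightarrow> nat \<Rightarrow> (real ^ 'd) set) \<Rightarrow> (nat \<Rightarrow> nat \<Rightarrow> real ^ 'd) \<Rightarrow>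
     real \<Rightarrow> real \<Rightarrow> (real ^ 'd \<Rightarrow> real) \<Rightarrow> (nat \<Rightarrow> real ^ 'd) \<Rightarrow> (nat \<Rightarrow> real ^ 'd) \<Rightarrow> bool" where
  "nc_DOO_run X L K cell rep \<delta> R f x xr \<longleftrightarrow>
     (\<exists>(act :: nat \<Rightarrow> (nat \<times> nat) set) (N :: nat \<Rightarrow> nat)
       (hs :: nat \<Rightarrow> nat) (js :: nat \<Rightarrow> nat) (ord :: nat \<Rightarrow> nat list).
        act 0 = {(0, 0)} \<and> N 0 = 1 \<and> x 1 = rep 0 0 \<and> xr 1 = x 1 \<and>
        (\<forall>k. is_arg_max (\<lambda>(h, i). f (rep h i) + L * R * \<delta> ^ h) (\<lambda>c. c \<in> act k) (hs k, js k) \<and>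
             (\<exists>J. children K cell (hs k) (js k) J \<and>
                  set (ord k) = {j \<in> J. cell (Suc (hs k)) j \<inter> X \<noteq> {}}) \<and>
             distinct (ord k) \<and>
             (\<forall>t<length (ord k). x (N k + Suc t) = rep (Suc (hs k)) (ord k ! t)) \<and>
             N (Suc k) = N k + length (ord k) \<and>
             act (Suc k) = (act k \<union> Pair (Suc (hs k)) ` set (ord k)) - {(hs k, js k)}) \<and>
        (\<forall>n\<ge>2. is_arg_max f (\<lambda>y. y \<in> x ` {1..n}) (xr n)))"

definition is_nc_DOO ::
    "(real ^ 'd \<Rightarrow> real) \<Rightarrow> (real ^ 'd) set \<Rightarrow> real \<Rightarrow> nat \<Rightarrow> (nat \<Rightarrow> nat \<Rightarrow> (real ^ 'd) set) \<Rightarrow>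
     (nat \<Rightarrow> nat \<Rightarrow> real ^ 'd) \<Rightarrow> real \<Rightarrow> real \<Rightarrow> 'd algorithm \<Rightarrow> bool" where
  "is_nc_DOO nrm X L K cell rep \<delta> R A \<longleftrightarrow>
     (\<forall>f\<in>lip_class nrm X L.
        nc_DOO_run X L K cell rep \<delta> R f (\<lambda>n. fst (A f n)) (\<lambda>n. snd (A f n)))"

definition eps0 :: "(real ^ 'd \<Rightarrow> real) \<Rightarrow> (real ^ 'd) set \<Rightarrow> real \<Rightarrow> real" where
  "eps0 nrm X L = L * (SUP (x, y)\<in>X \<times> X. nrm (x - y))"

definition num_levels :: "real \<Rightarrow> real \<Rightarrow> nat" where
  "num_levels e0 \<epsilon> = nat \<lceil>log 2 (e0 / \<epsilon>)\<rceil>"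

definition eps_level :: "real \<Rightarrow> real \<Rightarrow> nat \<Rightarrow> real" where
  "eps_level e0 \<epsilon> k = (if k = num_levels e0 \<epsilon> then \<epsilon> else e0 / 2 ^ k)"

definition doo_const :: "nat \<Rightarrow> nat \<Rightarrow> real \<Rightarrow> real \<Rightarrow> real" where
  "doo_const d K R \<nu> =
     real K * (of_bool (\<nu> / R \<ge> 1) + of_bool (\<nu> / R < 1) * (4 * R / \<nu>) ^ d)"

end

theory Submission
  imports Defs
begin

text \<open>
  Call \<open>max f - f u\<close> the gap of \<open>u\<close>.  The argument counts iterations rather than queries: each
  iteration queries at most \<open>K\<close> points, so it suffices to bound the number of iterations whose
  selected representative still has gap above \<open>\<epsilon>\<close>.

  The active cells always cover \<open>X\<close>.  As \<open>f\<close> is \<open>L\<close>-Lipschitz and a cell of depth \<open>h\<close> has diameter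
  at most \<open>R \<delta>^h\<close>, the score \<open>f (rep h i) + L R \<delta>^h\<close> bounds \<open>f\<close> from above on \<open>cell h i \<inter> X\<close>, so
  the largest active score bounds \<open>f\<close> on all of \<open>X\<close>.  Hence a selected cell of depth \<open>h\<close> has a
  representative with gap at most \<open>L R \<delta>^h\<close> (\<open>sel_gap_le\<close>).  Read backwards, a selected
  representative with gap above \<open>a\<close> lies in a cell with \<open>\<delta>^h > a / (L R)\<close>.  No cell is selected
  twice (\<open>inj_sel\<close>), so by (D2) the selected representatives with gap above \<open>a\<close> are more than
  \<open>\<nu> a / (L R)\<close> apart.  Those in the layer with gaps in \<open>(a, b]\<close> therefore form a packing of this
  layer (\<open>count_in_layer\<close>).

  If \<open>\<nu> \<ge> R\<close>, this is a packing at scale \<open>a / L\<close> already.  Otherwise a maximal subset that is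
  separated at scale \<open>a / L\<close> is also a net at that scale, and comparing volumes shows that each
  point of the net accounts for at most \<open>(4 R / \<nu>)^d\<close> points of the finer packing
  (\<open>card_separated_coarsen\<close>).  Adding up over the layers, which together contain every point with
  gap in \<open>(\<epsilon>, eps0]\<close>, bounds the number of iterations.
\<close>

section \<open>Volume bound for separated sets under an arbitrary norm\<close>

lemma is_normD:
  assumes "is_norm nrm"
  shows is_norm_nonneg: "0 \<le> nrm x"
    and is_norm_eq_0_iff: "nrm x = 0 \<longleftrightarrow> x = 0"
    and is_norm_scaleR: "nrm (c *\<^sub>R x) = \<bar>c\<bar> * nrm x"
    and is_norm_triangle: "nrm (x + y) \<le> nrm x + nrm y"
  using assms unfolding is_norm_def by simp_all

lemma is_norm_minus_commute:
  assumes "is_norm nrm"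
  shows "nrm (x - y) = nrm (y - x)"
  using is_norm_scaleR[OF assms, of "-1" "y - x"] by simp

lemma is_norm_triangle_diff:
  assumes "is_norm nrm"
  shows "nrm (x - z) \<le> nrm (x - y) + nrm (y - z)"
  using is_norm_triangle[OF assms, of "x - y" "y - z"] by simp

lemma is_norm_continuous:
  assumes "is_norm nrm"
  shows "continuous_on UNIV nrm"
proof (rule convex_on_continuous)
  show "convex_on UNIV nrm"
  proof (rule convex_onI)
    fix t :: real and x y
    assume t: "0 < t" "t < 1"
    have "nrm ((1 - t) *\<^sub>R x + t *\<^sub>R y) \<le> nrm ((1 - t) *\<^sub>R x) + nrm (t *\<^sub>R y)"
      by (rule is_norm_triangle[OF assms])
    also have "\<dots> = \<bar>1 - t\<bar> * nrm x + \<bar>t\<bar> * nrm y"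
      by (simp only: is_norm_scaleR[OF assms])
    finally show "nrm ((1 - t) *\<^sub>R x + t *\<^sub>R y) \<le> (1 - t) * nrm x + t * nrm y"
      using t by simp
  qed simp
qed simp

text \<open>
  The minimum of the norm on the compact Euclidean unit sphere is positive.  This makes the balls
  of the norm bounded, hence of finite volume.
\<close>

lemma is_norm_dominates_euclidean:
  fixes nrm :: "real ^ 'd \<Rightarrow> real"
  assumes "is_norm nrm"
  obtains c where "c > 0" "\<And>x. c * norm x \<le> nrm x"
proof -
  have "axis undefined 1 \<in> sphere (0 :: real ^ 'd) 1"
    by simp
  then have "sphere (0 :: real ^ 'd) 1 \<noteq> {}"
    by blast
  then obtain u :: "real ^ 'd" where u: "norm u = 1" "\<And>y. norm y = 1 \<Longrightarrow> nrm u \<le> nrm y"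
    using continuous_attains_inf[OF compact_sphere[of "0 :: real ^ 'd" 1] _
        continuous_on_subset[OF is_norm_continuous[OF assms] subset_UNIV]]
    by auto
  have "u \<noteq> 0" using u(1) by auto
  then have pos: "nrm u > 0"
    using is_norm_nonneg[OF assms, of u] is_norm_eq_0_iff[OF assms, of u] by linarith
  have "nrm u * norm x \<le> nrm x" for x
  proof (cases "x = 0")
    case True
    then show ?thesis using is_norm_nonneg[OF assms, of x] by simp
  next
    case False
    have "nrm ((1 / norm x) *\<^sub>R x) = \<bar>1 / norm x\<bar> * nrm x"
      by (rule is_norm_scaleR[OF assms])
    moreover have "nrm u \<le> nrm ((1 / norm x) *\<^sub>R x)"
      using False by (intro u(2)) simp
    ultimately have "nrm u \<le> nrm x / norm x"
      by simp
    then show ?thesis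
      using False by (simp add: pos_le_divide_eq)
  qed
  with pos show ?thesis using that by blast
qed

definition norm_ball :: "(real ^ 'd \<Rightarrow> real) \<Rightarrow> real ^ 'd \<Rightarrow> real \<Rightarrow> (real ^ 'd) set" where
  "norm_ball nrm a r = {y. nrm (y - a) < r}"

lemma open_norm_ball:
  assumes "is_norm nrm"
  shows "open (norm_ball nrm a r)"
proof -
  have "continuous_on UNIV (\<lambda>y. nrm (y - a))"
    by (intro continuous_on_compose2[OF is_norm_continuous[OF assms], where f = "\<lambda>y. y - a"]
        continuous_on_diff continuous_on_id continuous_on_const) simp
  then show ?thesis
    unfolding norm_ball_def by (intro open_Collect_less continuous_on_const)
qed

lemma norm_ball_lmeasurable:
  assumes "is_norm nrm"
  shows "norm_ball nrm a r \<in> lmeasurable"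
proof -
  obtain c where c: "c > 0" "\<And>x. c * norm x \<le> nrm x"
    using is_norm_dominates_euclidean[OF assms] by blast
  have "norm (y - a) \<le> r / c" if "y \<in> norm_ball nrm a r" for y
  proof -
    have "c * norm (y - a) \<le> r"
      using c(2)[of "y - a"] that unfolding norm_ball_def by simp
    then show ?thesis using c(1) by (simp add: field_simps)
  qed
  then have "norm_ball nrm a r \<subseteq> cball a (r / c)"
    by (auto simp: dist_norm norm_minus_commute)
  then have "bounded (norm_ball nrm a r)"
    using bounded_cball bounded_subset by blast
  then show ?thesis
    using open_norm_ball[OF assms] lmeasurable_open by blast
qed

text \<open>
  The volume of the unit ball is never computed; it cancels when two balls are compared.
\<close>

lemma measure_norm_ball:
  fixes nrm :: "real ^ 'd \<Rightarrow> real"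
  assumes "is_norm nrm" "0 < r"
  shows "measure lebesgue (norm_ball nrm a r) =
    r ^ CARD('d) * measure lebesgue (norm_ball nrm 0 1)"
proof -
  note scale = is_norm_scaleR[OF assms(1)]
  have "norm_ball nrm a r = (\<lambda>x. r *\<^sub>R x + a) ` norm_ball nrm 0 1"
  proof (intro equalityI subsetI)
    fix y assume "y \<in> norm_ball nrm a r"
    then have "nrm ((1 / r) *\<^sub>R (y - a)) < 1"
      unfolding norm_ball_def scale using assms(2) by simp
    then have "(1 / r) *\<^sub>R (y - a) \<in> norm_ball nrm 0 1"
      unfolding norm_ball_def by simp
    moreover have "y = r *\<^sub>R ((1 / r) *\<^sub>R (y - a)) + a"
      using assms(2) by simp
    ultimately show "y \<in> (\<lambda>x. r *\<^sub>R x + a) ` norm_ball nrm 0 1"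
      by blast
  next
    fix y assume "y \<in> (\<lambda>x. r *\<^sub>R x + a) ` norm_ball nrm 0 1"
    then show "y \<in> norm_ball nrm a r"
      unfolding norm_ball_def using assms(2) by (auto simp: scale)
  qed
  then show ?thesis
    using measure_lebesgue_affine[of r a "norm_ball nrm 0 1"] assms(2) by simp
qed

lemma measure_unit_norm_ball_pos:
  assumes "is_norm nrm"
  shows "measure lebesgue (norm_ball nrm 0 1) > 0"
proof -
  have "0 \<in> norm_ball nrm 0 1"
    unfolding norm_ball_def using is_norm_eq_0_iff[OF assms, of 0] by simp
  then have "\<not> negligible (norm_ball nrm 0 1)"
    using open_not_negligible[OF open_norm_ball[OF assms]] by blast
  then show ?thesis
    using negligible_iff_measure0[OF norm_ball_lmeasurable[OF assms]]
    by (metis measure_nonneg less_eq_real_def)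
qed

text \<open>
  The open balls of radius \<open>r / 2\<close> around the points are disjoint and lie in the ball of radius
  \<open>s + r / 2\<close> around \<open>a\<close>.  Volumes give the bound \<open>(1 + 2 s / r)^d\<close>, which is at
  most \<open>(4 s / r)^d\<close> since \<open>r \<le> s\<close>.
\<close>

lemma card_separated_in_norm_ball:
  fixes nrm :: "real ^ 'd \<Rightarrow> real"
  assumes nrm: "is_norm nrm" and "finite S" and "0 < r" "r \<le> s"
    and sep: "\<And>x y. x \<in> S \<Longrightarrow> y \<in> S \<Longrightarrow> x \<noteq> y \<Longrightarrow> nrm (x - y) > r"
    and near: "\<And>x. x \<in> S \<Longrightarrow> nrm (x - a) \<le> s"
  shows "real (card S) \<le> (4 * s / r) ^ CARD('d)"
proof -
  let ?V = "measure lebesgue (norm_ball nrm 0 1)"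
  let ?B = "\<lambda>x. norm_ball nrm x (r / 2)"
  have disj: "disjoint_family_on ?B S"
    unfolding disjoint_family_on_def
  proof (intro ballI impI, rule ccontr)
    fix x y assume "x \<in> S" "y \<in> S" "x \<noteq> y" "?B x \<inter> ?B y \<noteq> {}"
    then obtain z where "nrm (z - x) < r / 2" "nrm (z - y) < r / 2"
      unfolding norm_ball_def by blast
    with sep[OF \<open>x \<in> S\<close> \<open>y \<in> S\<close> \<open>x \<noteq> y\<close>] show False
      using is_norm_triangle_diff[OF nrm, of x y z] is_norm_minus_commute[OF nrm, of x z] by linarith
  qed
  have sub: "(\<Union>x\<in>S. ?B x) \<subseteq> norm_ball nrm a (s + r / 2)"
  proof
    fix z assume "z \<in> (\<Union>x\<in>S. ?B x)"
    then obtain x where "x \<in> S" "nrm (z - x) < r / 2"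
      unfolding norm_ball_def by blast
    with near[of x] show "z \<in> norm_ball nrm a (s + r / 2)"
      unfolding norm_ball_def using is_norm_triangle_diff[OF nrm, of z a x] by simp
  qed
  have fin: "emeasure lebesgue (?B x) \<noteq> \<infinity>" for x
    unfolding infinity_ennreal_def by (rule fmeasurableD2[OF norm_ball_lmeasurable[OF nrm]])
  have "(\<Sum>x\<in>S. measure lebesgue (?B x)) = (\<Sum>x\<in>S. (r / 2) ^ CARD('d) * ?V)"
    using \<open>0 < r\<close> by (intro sum.cong refl measure_norm_ball[OF nrm]) simp
  then have "real (card S) * ((r / 2) ^ CARD('d) * ?V) = (\<Sum>x\<in>S. measure lebesgue (?B x))"
    by simp
  also have "\<dots> = measure lebesgue (\<Union>x\<in>S. ?B x)"
    by (intro measure_finite_Union[symmetric] \<open>finite S\<close> disj image_subsetI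
        fmeasurableD norm_ball_lmeasurable[OF nrm] fin)
  also have "\<dots> \<le> measure lebesgue (norm_ball nrm a (s + r / 2))"
    by (intro measure_mono_fmeasurable sub sets.finite_UN \<open>finite S\<close> fmeasurableD
        norm_ball_lmeasurable[OF nrm])
  also have "\<dots> = (s + r / 2) ^ CARD('d) * ?V"
    using assms(3,4) by (intro measure_norm_ball[OF nrm]) simp
  finally have "real (card S) * (r / 2) ^ CARD('d) \<le> (s + r / 2) ^ CARD('d)"
    using measure_unit_norm_ball_pos[OF nrm]
    by (simp only: mult.assoc[symmetric] mult_le_cancel_right_pos)
  then have "real (card S) \<le> ((s + r / 2) / (r / 2)) ^ CARD('d)"
    unfolding power_divide[of _ "r / 2"] using \<open>0 < r\<close>
    by (simp only: pos_le_divide_eq zero_less_power half_gt_zero)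
  also have "\<dots> \<le> (4 * s / r) ^ CARD('d)"
  proof (rule power_mono)
    have "(s + r / 2) / (r / 2) = (2 * s + r) / r"
      using \<open>0 < r\<close> by (simp add: field_simps)
    also have "\<dots> \<le> 4 * s / r"
      using assms(3,4) by (intro divide_right_mono) simp_all
    finally show "(s + r / 2) / (r / 2) \<le> 4 * s / r" .
    show "0 \<le> (s + r / 2) / (r / 2)"
      using assms(3,4) by simp
  qed
  finally show ?thesis .
qed

section \<open>Comparing packings at two scales\<close>

lemma exists_maximal_separated_subset:
  fixes nrm :: "real ^ 'd \<Rightarrow> real"
  assumes "finite S"
  obtains M where "M \<subseteq> S" "\<And>x y. x \<in> M \<Longrightarrow> y \<in> M \<Longrightarrow> x \<noteq> y \<Longrightarrow> nrm (x - y) > s"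
    and "\<And>x. x \<in> S \<Longrightarrow> x \<notin> M \<Longrightarrow> \<exists>y\<in>M. nrm (x - y) \<le> s \<or> nrm (y - x) \<le> s"
proof -
  define sep where "sep M \<longleftrightarrow> M \<subseteq> S \<and> (\<forall>x\<in>M. \<forall>y\<in>M. x \<noteq> y \<longrightarrow> nrm (x - y) > s)" for M
  have "finite (Collect sep)"
    by (rule finite_subset[of _ "Pow S"]) (auto simp: assms sep_def)
  moreover have "{} \<in> Collect sep" by (simp add: sep_def)
  ultimately obtain M where M: "sep M" and max: "\<And>M'. sep M' \<Longrightarrow> M \<subseteq> M' \<Longrightarrow> M = M'"
    using finite_has_maximal[of "Collect sep"] by auto
  show ?thesis
  proof (rule that[of M])
    show "M \<subseteq> S" "\<And>x y. x \<in> M \<Longrightarrow> y \<in> M \<Longrightarrow> x \<noteq> y \<Longrightarrow> nrm (x - y) > s"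
      using M unfolding sep_def by simp_all
    fix x assume x: "x \<in> S" "x \<notin> M"
    show "\<exists>y\<in>M. nrm (x - y) \<le> s \<or> nrm (y - x) \<le> s"
    proof (rule ccontr)
      assume "\<not> ?thesis"
      then have "sep (insert x M)"
        using M x(1) unfolding sep_def by (simp add: not_le)
      from max[OF this] x(2) show False by auto
    qed
  qed
qed

text \<open>
  The packing number enumerates its points by \<open>1, \<dots>, k\<close>; finite sets avoid this indexing in
  everything that follows.
\<close>

lemma card_separated_le_packing_number:
  assumes "finite M" "M \<subseteq> E"
    and sep: "\<And>x y. x \<in> M \<Longrightarrow> y \<in> M \<Longrightarrow> x \<noteq> y \<Longrightarrow> nrm (x - y) > r"
  shows "enat (card M) \<le> packing_number nrm E r"
proof (cases "M = {}")
  case True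
  then show ?thesis by (simp add: zero_enat_def[symmetric])
next
  case False
  obtain g where g: "bij_betw g {1..card M} M"
    using ex_bij_betw_nat_finite_1[OF assms(1)] by blast
  note gM = bij_betwE[OF g]
  have "1 \<le> card M"
    using False assms(1) by (metis card_0_eq less_one not_le)
  moreover have "\<forall>i\<in>{1..card M}. g i \<in> E"
    using gM assms(2) by blast
  moreover have "\<forall>i\<in>{1..card M}. \<forall>j\<in>{1..card M}. i \<noteq> j \<longrightarrow> nrm (g i - g j) > r"
  proof (intro ballI impI sep)
    fix i j assume ij: "i \<in> {1..card M}" "j \<in> {1..card M}" "i \<noteq> j"
    then show "g i \<in> M" "g j \<in> M" using gM by blast+
    show "g i \<noteq> g j"
      using inj_onD[OF bij_betw_imp_inj_on[OF g]] ij by blast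
  qed
  ultimately have "enat (card M) \<le>
      (SUP k\<in>{k. 1 \<le> k \<and> (\<exists>x. (\<forall>i\<in>{1..k}. x i \<in> E) \<and>
             (\<forall>i\<in>{1..k}. \<forall>j\<in>{1..k}. i \<noteq> j \<longrightarrow> nrm (x i - x j) > r))}. enat k)"
    by (intro SUP_upper CollectI conjI exI[of _ g])
  moreover have "E \<noteq> {}" using False assms(2) by blast
  ultimately show ?thesis unfolding packing_number_def by simp
qed

text \<open>
  A maximal \<open>s\<close>-separated subset \<open>M\<close> of \<open>S\<close> is an \<open>s\<close>-net of \<open>S\<close>, so \<open>S\<close> is covered by \<open>card M\<close>
  clusters of radius \<open>s\<close>, each of which is small by volume.  Since \<open>M\<close> is chosen inside the finite
  set \<open>S\<close>, a possibly infinite packing number of \<open>E\<close> needs no separate treatment.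
\<close>

lemma card_separated_coarsen:
  fixes nrm :: "real ^ 'd \<Rightarrow> real"
  assumes nrm: "is_norm nrm" and "finite S" "S \<subseteq> E" and "0 < r" "r \<le> s"
    and sep: "\<And>x y. x \<in> S \<Longrightarrow> y \<in> S \<Longrightarrow> x \<noteq> y \<Longrightarrow> nrm (x - y) > r"
  shows "ereal (real (card S)) \<le>
    ereal ((4 * s / r) ^ CARD('d)) * ereal_of_enat (packing_number nrm E s)"
proof -
  obtain M where M: "M \<subseteq> S" "\<And>x y. x \<in> M \<Longrightarrow> y \<in> M \<Longrightarrow> x \<noteq> y \<Longrightarrow> nrm (x - y) > s"
    and cover: "\<And>x. x \<in> S \<Longrightarrow> x \<notin> M \<Longrightarrow> \<exists>y\<in>M. nrm (x - y) \<le> s \<or> nrm (y - x) \<le> s"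
    using exists_maximal_separated_subset[OF \<open>finite S\<close>, where nrm = nrm and s = s] by metis
  have finM: "finite M" using M(1) \<open>finite S\<close> finite_subset by blast
  let ?C = "(4 * s / r) ^ CARD('d)"
  have zero: "nrm 0 = 0" using is_norm_eq_0_iff[OF nrm] by blast
  have "S \<subseteq> (\<Union>a\<in>M. {x\<in>S. nrm (x - a) \<le> s})"
  proof
    fix x assume x: "x \<in> S"
    show "x \<in> (\<Union>a\<in>M. {x\<in>S. nrm (x - a) \<le> s})"
    proof (cases "x \<in> M")
      case True
      then show ?thesis using x zero assms(4,5) by (intro UN_I[of x]) simp_all
    next
      case False
      then obtain y where "y \<in> M" "nrm (x - y) \<le> s \<or> nrm (y - x) \<le> s"
        using cover[OF x] by blast
      then show ?thesis
        using x is_norm_minus_commute[OF nrm, of x y] by (intro UN_I[of y]) simp_all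
    qed
  qed
  then have "card S \<le> card (\<Union>a\<in>M. {x\<in>S. nrm (x - a) \<le> s})"
    using finM \<open>finite S\<close> by (intro card_mono) auto
  also have "\<dots> \<le> (\<Sum>a\<in>M. card {x\<in>S. nrm (x - a) \<le> s})"
    by (rule card_UN_le[OF finM])
  finally have "real (card S) \<le> (\<Sum>a\<in>M. real (card {x\<in>S. nrm (x - a) \<le> s}))"
    unfolding of_nat_sum[symmetric] of_nat_le_iff .
  also have "\<dots> \<le> (\<Sum>a\<in>M. ?C)"
    using assms(2,4,5) sep by (intro sum_mono card_separated_in_norm_ball[OF nrm]) auto
  finally have "real (card S) \<le> ?C * real (card M)"
    by (simp add: mult.commute)
  then have "ereal (real (card S)) \<le> ereal ?C * ereal_of_enat (enat (card M))"
    by simp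
  also have "\<dots> \<le> ereal ?C * ereal_of_enat (packing_number nrm E s)"
  proof (rule ereal_mult_left_mono)
    have "enat (card M) \<le> packing_number nrm E s"
      by (rule card_separated_le_packing_number[OF finM]) (use M \<open>S \<subseteq> E\<close> in blast)+
    then show "ereal_of_enat (enat (card M)) \<le> ereal_of_enat (packing_number nrm E s)"
      by (simp only: ereal_of_enat_le_iff)
    show "0 \<le> ereal ?C" using assms(4,5) by simp
  qed
  finally show ?thesis .
qed

text \<open>
  The two indicators in \<open>doo_const\<close> are the two cases of this proof: separation \<open>\<nu> s / R\<close> is at
  least \<open>s\<close> or has to be coarsened to \<open>s\<close>.  The factor \<open>K\<close> is the cost of one iteration.
\<close>

lemma card_separated_le_doo_const:
  fixes nrm :: "real ^ 'd \<Rightarrow> real"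
  assumes nrm: "is_norm nrm" and "finite S" "S \<subseteq> E" and "0 < s" "0 < R" "0 < \<nu>"
    and sep: "\<And>x y. x \<in> S \<Longrightarrow> y \<in> S \<Longrightarrow> x \<noteq> y \<Longrightarrow> nrm (x - y) > \<nu> * s / R"
  shows "ereal (real K * real (card S)) \<le>
    ereal (doo_const CARD('d) K R \<nu>) * ereal_of_enat (packing_number nrm E s)"
proof (cases "\<nu> / R \<ge> 1")
  case True
  have "s \<le> (\<nu> / R) * s"
    using mult_right_mono[OF True, of s] \<open>0 < s\<close> by simp
  then have "enat (card S) \<le> packing_number nrm E s"
    using sep by (intro card_separated_le_packing_number assms(2,3)) fastforce
  then have "ereal_of_enat (enat (card S)) \<le> ereal_of_enat (packing_number nrm E s)"
    by (simp only: ereal_of_enat_le_iff)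
  then have "ereal (real K) * ereal (real (card S)) \<le>
      ereal (real K) * ereal_of_enat (packing_number nrm E s)"
    by (intro ereal_mult_left_mono) simp_all
  then show ?thesis
    using True unfolding doo_const_def by simp
next
  case False
  let ?C = "(4 * R / \<nu>) ^ CARD('d)"
  have C: "(4 * s / (\<nu> * s / R)) ^ CARD('d) = ?C"
    using \<open>0 < s\<close> \<open>0 < R\<close> \<open>0 < \<nu>\<close> by simp
  have "\<nu> / R * s \<le> 1 * s"
    using False \<open>0 < s\<close> by (intro mult_right_mono) simp_all
  then have "\<nu> * s / R \<le> s"
    by simp
  then have "ereal (real (card S)) \<le> ereal ?C * ereal_of_enat (packing_number nrm E s)"
    using card_separated_coarsen[OF nrm assms(2,3) _ _ sep, of s] assms(4-6) C by simp
  then have "ereal (real K) * ereal (real (card S)) \<le>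
      ereal (real K) * (ereal ?C * ereal_of_enat (packing_number nrm E s))"
    by (intro ereal_mult_left_mono) simp_all
  then show ?thesis
    using False unfolding doo_const_def by (simp add: mult.assoc[symmetric])
qed

section \<open>Dyadic levels of the optimality gap\<close>

text \<open>
  When there is no level at all, \<open>eps_level e0 \<epsilon> 0\<close> is \<open>\<epsilon>\<close> instead of \<open>e0\<close>.  This case is excluded
  as soon as some gap lies strictly above \<open>\<epsilon>\<close> and not above \<open>e0\<close>.
\<close>

lemma num_levels_pos:
  assumes "0 < \<epsilon>" "\<epsilon> < e0"
  shows "0 < num_levels e0 \<epsilon>"
proof -
  have "0 < log 2 (e0 / \<epsilon>)"
    using assms by (simp add: field_simps)
  then show ?thesis
    unfolding num_levels_def by simp
qed

lemma eps_level_pos: "0 < \<epsilon> \<Longrightarrow> 0 < e0 \<Longrightarrow> 0 < eps_level e0 \<epsilon> k"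
  unfolding eps_level_def by simp

text \<open>
  The levels start at \<open>e0 \<ge> g\<close> and end at \<open>\<epsilon> < g\<close>, so there is a first level below \<open>g\<close>, and it
  is not level 0.
\<close>

lemma eps_level_bracket:
  assumes "0 < \<epsilon>" "\<epsilon> < g" "g \<le> e0"
  obtains k where "k \<in> {1..num_levels e0 \<epsilon>}" "eps_level e0 \<epsilon> k < g" "g \<le> eps_level e0 \<epsilon> (k - 1)"
proof -
  let ?m = "num_levels e0 \<epsilon>"
  define k where "k = (LEAST k. eps_level e0 \<epsilon> k < g)"
  have m: "eps_level e0 \<epsilon> ?m < g"
    using assms(2) unfolding eps_level_def by simp
  have k: "eps_level e0 \<epsilon> k < g"
    unfolding k_def by (rule LeastI[of "\<lambda>k. eps_level e0 \<epsilon> k < g", OF m])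
  have "k \<le> ?m"
    unfolding k_def by (rule Least_le[of "\<lambda>k. eps_level e0 \<epsilon> k < g", OF m])
  have "eps_level e0 \<epsilon> 0 = e0"
    using num_levels_pos[of \<epsilon> e0] assms unfolding eps_level_def by simp
  then have "k \<noteq> 0"
    using k assms(3) by (metis not_less)
  then have "\<not> eps_level e0 \<epsilon> (k - 1) < g"
    unfolding k_def by (intro not_less_Least) simp
  with k \<open>k \<le> ?m\<close> \<open>k \<noteq> 0\<close> show ?thesis
    by (intro that[of k]) simp_all
qed

section \<open>Invariants of a run\<close>

lemma lip_class_le:
  assumes nrm: "is_norm nrm" and "f \<in> lip_class nrm X L" "u \<in> X" "v \<in> X"
  shows "f u - f v \<le> L * nrm (u - v)"
proof -
  have "Inf {c. lip_bound nrm X f c} < L" "{c. lip_bound nrm X f c} \<noteq> {}"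
    using assms(2) unfolding lip_class_def lip_const_def by simp_all
  then obtain c where c: "lip_bound nrm X f c" "c < L"
    using cInf_lessD by (metis mem_Collect_eq)
  have "\<bar>f u - f v\<bar> \<le> c * nrm (u - v)"
    using c(1) assms(3,4) unfolding lip_bound_def by simp
  also have "\<dots> \<le> L * nrm (u - v)"
    using c(2) is_norm_nonneg[OF nrm] by (intro mult_right_mono) simp_all
  finally show ?thesis by linarith
qed

text \<open>
  The witnesses of one run on one function are fixed here together with the hypotheses on norm,
  domain and cells, so that the invariants can be stated about them directly.
\<close>

locale nc_doo_execution =
  fixes nrm :: "real ^ 'd \<Rightarrow> real" and X :: "(real ^ 'd) set"
    and L \<delta> R \<nu> :: real and K :: nat
    and cell :: "nat \<Rightarrow> nat \<Rightarrow> (real ^ 'd) set" and rep :: "nat \<Rightarrow> nat \<Rightarrow> real ^ 'd"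
    and f :: "real ^ 'd \<Rightarrow> real" and x xr :: "nat \<Rightarrow> real ^ 'd"
    and act :: "nat \<Rightarrow> (nat \<times> nat) set" and N hs js :: "nat \<Rightarrow> nat" and ord :: "nat \<Rightarrow> nat list"
  assumes nrm: "is_norm nrm"
    and X_nonempty: "X \<noteq> {}"
    and L_pos: "0 < L"
    and hierarchy: "cell_hierarchy X K cell rep"
    and D1: "cond_D1 nrm K cell \<delta> R"
    and D2: "cond_D2 nrm K rep \<delta> \<nu>"
    and f_lip: "f \<in> lip_class nrm X L"
    and act_0: "act 0 = {(0, 0)}"
    and N_0: "N 0 = 1"
    and x_1: "x 1 = rep 0 0"
    and xr_1: "xr 1 = x 1"
    and selection:
      "\<And>k. is_arg_max (\<lambda>(h, i). f (rep h i) + L * R * \<delta> ^ h) (\<lambda>c. c \<in> act k) (hs k, js k)"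
    and expansion: "\<And>k. \<exists>J. children K cell (hs k) (js k) J \<and>
      set (ord k) = {j \<in> J. cell (Suc (hs k)) j \<inter> X \<noteq> {}}"
    and ord_distinct: "\<And>k. distinct (ord k)"
    and queries: "\<And>k t. t < length (ord k) \<Longrightarrow> x (N k + Suc t) = rep (Suc (hs k)) (ord k ! t)"
    and N_Suc: "\<And>k. N (Suc k) = N k + length (ord k)"
    and act_Suc:
      "\<And>k. act (Suc k) = (act k \<union> Pair (Suc (hs k)) ` set (ord k)) - {(hs k, js k)}"
    and recommendation: "\<And>n. 2 \<le> n \<Longrightarrow> is_arg_max f (\<lambda>y. y \<in> x ` {1..n}) (xr n)"
begin

definition sel :: "nat \<Rightarrow> nat \<times> nat" where
  "sel k = (hs k, js k)"

abbreviation gap :: "real ^ 'd \<Rightarrow> real" where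
  "gap u \<equiv> max_on X f - f u"

lemma R_pos: "0 < R" and \<delta>_pos: "0 < \<delta>" and \<nu>_pos: "0 < \<nu>"
  using D1 D2 unfolding cond_D1_def cond_D2_def by simp_all

lemma cell_diameter:
  assumes "i < K ^ h" "u \<in> cell h i" "v \<in> cell h i"
  shows "nrm (u - v) \<le> R * \<delta> ^ h"
  using D1 assms unfolding cond_D1_def by simp

lemma rep_separation:
  assumes "i < K ^ h" "i' < K ^ h'" "(h, i) \<noteq> (h', i')"
  shows "\<nu> * \<delta> ^ max h h' \<le> nrm (rep h i - rep h' i')"
  using D2 assms unfolding cond_D2_def by blast

lemma rep_in_cell:
  assumes "i < K ^ h"
  shows "rep h i \<in> cell h i"
  using hierarchy assms unfolding cell_hierarchy_def by blast

lemma rep_in_X: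
  assumes "i < K ^ h" "cell h i \<inter> X \<noteq> {}"
  shows "rep h i \<in> X"
  using hierarchy assms unfolding cell_hierarchy_def by blast

lemma cell_nonempty:
  assumes "i < K ^ h"
  shows "cell h i \<noteq> {}"
  using rep_in_cell[OF assms] by blast

lemma cell_unique:
  assumes "i < K ^ h" "i' < K ^ h" "cell h i \<inter> cell h i' \<noteq> {}"
  shows "i = i'"
proof -
  have "disjoint_family_on (cell h) {..<K ^ h}"
    using hierarchy unfolding cell_hierarchy_def by blast
  then show ?thesis
    using assms unfolding disjoint_family_on_def by blast
qed

lemma X_subset_root: "X \<subseteq> cell 0 0"
proof -
  have "X \<subseteq> (\<Union>i<K ^ 0. cell 0 i)"
    using hierarchy unfolding cell_hierarchy_def by blast
  moreover have "{..<K ^ 0} = {0}" by auto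
  ultimately show ?thesis by simp
qed

text \<open>
  The supremum in \<open>eps0\<close> is meaningful because all of \<open>X\<close> lies in the root cell, whose diameter
  is at most \<open>R\<close>.
\<close>

lemma diff_le_eps0:
  assumes "u \<in> X" "v \<in> X"
  shows "f u - f v \<le> eps0 nrm X L"
proof -
  have "nrm (fst p - snd p) \<le> R" if "p \<in> X \<times> X" for p
    using cell_diameter[of 0 0 "fst p" "snd p"] subsetD[OF X_subset_root] that
    by (simp add: mem_Times_iff)
  then have "bdd_above ((\<lambda>(a, b). nrm (a - b)) ` (X \<times> X))"
    by (intro bdd_aboveI2[of _ _ R]) auto
  then have "nrm (u - v) \<le> (SUP (a, b)\<in>X \<times> X. nrm (a - b))"
    using cSUP_upper[of "(u, v)" "X \<times> X" "\<lambda>(a, b). nrm (a - b)"] assms by simp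
  then have "L * nrm (u - v) \<le> eps0 nrm X L"
    unfolding eps0_def using L_pos by (intro mult_left_mono) simp_all
  with lip_class_le[OF nrm f_lip assms] show ?thesis by linarith
qed

lemma gap_le_eps0:
  assumes "u \<in> X"
  shows "gap u \<le> eps0 nrm X L"
proof -
  have "max_on X f \<le> f u + eps0 nrm X L"
    unfolding max_on_def using diff_le_eps0[OF _ assms]
    by (intro cSUP_least X_nonempty) (simp add: algebra_simps)
  then show ?thesis by simp
qed

lemma sel_in_act: "sel k \<in> act k"
  using selection[of k] unfolding is_arg_max_def sel_def by simp

lemma expansion_children:
  obtains J where "finite J" "card J = K" "set (ord k) = {j \<in> J. cell (Suc (hs k)) j \<inter> X \<noteq> {}}"
    and "\<And>j. j \<in> J \<Longrightarrow> j < K ^ Suc (hs k)"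
    and "cell (hs k) (js k) = (\<Union>j\<in>J. cell (Suc (hs k)) j)"
proof -
  obtain J where J: "children K cell (hs k) (js k) J"
    "set (ord k) = {j \<in> J. cell (Suc (hs k)) j \<inter> X \<noteq> {}}"
    using expansion by blast
  have sub: "J \<subseteq> {..<K ^ Suc (hs k)}" and card: "card J = K"
    and part: "partition_on (cell (hs k) (js k)) (cell (Suc (hs k)) ` J)"
    using J(1) unfolding children_def by simp_all
  show ?thesis
  proof (rule that[OF _ card J(2) _ partition_onD1[OF part]])
    show "finite J"
      using sub by (rule finite_subset) simp
    show "j < K ^ Suc (hs k)" if "j \<in> J" for j
      using sub that by blast
  qed
qed

lemma child_in_parent:
  assumes "j \<in> set (ord k)"
  shows "j < K ^ Suc (hs k)" "cell (Suc (hs k)) j \<inter> X \<noteq> {}"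
    "cell (Suc (hs k)) j \<subseteq> cell (hs k) (js k)"
proof -
  obtain J where J: "set (ord k) = {j \<in> J. cell (Suc (hs k)) j \<inter> X \<noteq> {}}"
    "\<And>j. j \<in> J \<Longrightarrow> j < K ^ Suc (hs k)"
    "cell (hs k) (js k) = (\<Union>j\<in>J. cell (Suc (hs k)) j)"
    by (rule expansion_children[of k], rule that)
  then show "j < K ^ Suc (hs k)" "cell (Suc (hs k)) j \<inter> X \<noteq> {}"
    "cell (Suc (hs k)) j \<subseteq> cell (hs k) (js k)"
    using assms by blast+
qed

lemma length_ord_le: "length (ord k) \<le> K"
proof -
  obtain J where J: "finite J" "card J = K" "set (ord k) = {j \<in> J. cell (Suc (hs k)) j \<inter> X \<noteq> {}}"
    by (rule expansion_children[of k], rule that)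
  have "length (ord k) = card (set (ord k))"
    using distinct_card[OF ord_distinct] by simp
  also have "\<dots> \<le> card J"
    using J by (intro card_mono) auto
  finally show ?thesis using J(2) by simp
qed

lemma act_SucE:
  assumes "c \<in> act (Suc k)"
  obtains "c \<in> act k" "c \<noteq> sel k" | j where "j \<in> set (ord k)" "c = (Suc (hs k), j)"
  using assms unfolding act_Suc sel_def by blast

lemma act_valid: "(h, i) \<in> act k \<Longrightarrow> i < K ^ h \<and> cell h i \<inter> X \<noteq> {}"
proof (induction k arbitrary: h i)
  case 0
  then show ?case
    using act_0 X_subset_root X_nonempty by auto
next
  case (Suc k)
  from Suc.prems show ?case
  proof (cases rule: act_SucE)
    case 1
    then show ?thesis using Suc.IH by simp
  next
    case (2 j)
    then show ?thesis using child_in_parent[OF 2(1)] by simp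
  qed
qed

lemma sel_valid: "js k < K ^ hs k" "cell (hs k) (js k) \<inter> X \<noteq> {}"
  using act_valid[of "hs k" "js k" k] sel_in_act[of k] unfolding sel_def by simp_all

lemma sel_rep_in_X: "rep (hs k) (js k) \<in> X"
  using rep_in_X sel_valid by blast

text \<open>
  Replacing a cell by its children loses no point of \<open>X\<close>: a child that is skipped does not meet
  \<open>X\<close>.
\<close>

lemma act_covers_X:
  assumes "u \<in> X"
  shows "\<exists>h i. (h, i) \<in> act k \<and> u \<in> cell h i"
proof (induction k)
  case 0
  then show ?case using act_0 X_subset_root assms by auto
next
  case (Suc k)
  then obtain h i where hi: "(h, i) \<in> act k" "u \<in> cell h i" by blast
  show ?case
  proof (cases "(h, i) = sel k")
    case False
    then have "(h, i) \<in> act (Suc k)"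
      using hi(1) unfolding act_Suc sel_def by blast
    then show ?thesis using hi(2) by blast
  next
    case True
    then have u: "u \<in> cell (hs k) (js k)" using hi(2) unfolding sel_def by simp
    obtain J where J: "set (ord k) = {j \<in> J. cell (Suc (hs k)) j \<inter> X \<noteq> {}}"
      "cell (hs k) (js k) = (\<Union>j\<in>J. cell (Suc (hs k)) j)"
      by (rule expansion_children[of k], rule that)
    then obtain j where j: "j \<in> J" "u \<in> cell (Suc (hs k)) j" using u by blast
    then have "j \<in> set (ord k)" using J(1) assms by blast
    then have "(Suc (hs k), j) \<in> act (Suc k)" unfolding act_Suc by simp
    then show ?thesis using j(2) by blast
  qed
qed

text \<open>
  The optimism principle behind DOO.  The score of an active cell dominates \<open>f\<close> on the part of
  its cell in \<open>X\<close>, and the active cells cover \<open>X\<close>, so the largest score dominates \<open>f\<close> everywhere on \<open>X\<close>, and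
  so dominates its supremum.
\<close>

lemma sel_gap_le: "gap (rep (hs k) (js k)) \<le> L * R * \<delta> ^ hs k"
proof -
  have "f u \<le> f (rep (hs k) (js k)) + L * R * \<delta> ^ hs k" if u: "u \<in> X" for u
  proof -
    obtain h i where hi: "(h, i) \<in> act k" "u \<in> cell h i"
      using act_covers_X[OF u] by blast
    have i: "i < K ^ h" and X: "rep h i \<in> X"
      using act_valid[OF hi(1)] rep_in_X by blast+
    have "f u - f (rep h i) \<le> L * nrm (u - rep h i)"
      by (rule lip_class_le[OF nrm f_lip u X])
    also have "\<dots> \<le> L * (R * \<delta> ^ h)"
      using L_pos by (intro mult_left_mono cell_diameter[OF i hi(2) rep_in_cell[OF i]]) simp
    finally have "f u \<le> f (rep h i) + L * R * \<delta> ^ h"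
      by simp
    moreover have "f (rep h i) + L * R * \<delta> ^ h \<le> f (rep (hs k) (js k)) + L * R * \<delta> ^ hs k"
      using selection[of k] hi(1) unfolding is_arg_max_linorder by fastforce
    ultimately show ?thesis by linarith
  qed
  then have "max_on X f \<le> f (rep (hs k) (js k)) + L * R * \<delta> ^ hs k"
    unfolding max_on_def by (intro cSUP_least X_nonempty)
  then show ?thesis by simp
qed

lemma N_mono: "k \<le> l \<Longrightarrow> N k \<le> N l"
  by (rule lift_Suc_mono_le[of N]) (simp_all add: N_Suc)

lemma N_pos: "1 \<le> N k"
  using N_mono[of 0 k] N_0 by simp

lemma N_le: "N k \<le> 1 + K * k"
proof (induction k)
  case 0
  then show ?case using N_0 by simp
next
  case (Suc k)
  then show ?case using N_Suc[of k] length_ord_le[of k] by simp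
qed

lemma act_queried: "(h, i) \<in> act k \<Longrightarrow> rep h i \<in> x ` {1..N k}"
proof (induction k arbitrary: h i)
  case 0
  then have "rep h i = x 1" using act_0 x_1 by simp
  then show ?case using N_0 by simp
next
  case (Suc k)
  from Suc.prems show ?case
  proof (cases rule: act_SucE)
    case 1
    moreover have "{1..N k} \<subseteq> {1..N (Suc k)}" using N_Suc by simp
    ultimately show ?thesis using Suc.IH by blast
  next
    case (2 j)
    then obtain t where t: "t < length (ord k)" "ord k ! t = j"
      by (metis in_set_conv_nth)
    then have "rep h i = x (N k + Suc t)" using queries[of t k] 2 by simp
    moreover have "N k + Suc t \<in> {1..N (Suc k)}" using t(1) N_Suc[of k] by simp
    ultimately show ?thesis by blast
  qed
qed

lemma recommendation_best:
  assumes "y \<in> x ` {1..N k}"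
  shows "f y \<le> f (xr (N k))"
proof (cases "2 \<le> N k")
  case True
  then show ?thesis using recommendation[OF True] assms unfolding is_arg_max_linorder by blast
next
  case False
  then have "N k = 1" using N_pos[of k] by simp
  then show ?thesis using assms xr_1 by auto
qed

text \<open>
  A cell is active before it is selected, so its representative has been queried by then and
  competes for every later recommendation.
\<close>

lemma gap_recommendation_le_sel:
  assumes "l \<le> k"
  shows "gap (xr (N k)) \<le> gap (rep (hs l) (js l))"
proof -
  have "rep (hs l) (js l) \<in> x ` {1..N l}"
    using act_queried sel_in_act unfolding sel_def by blast
  moreover have "{1..N l} \<subseteq> {1..N k}" using N_mono[OF assms] by simp
  ultimately have "rep (hs l) (js l) \<in> x ` {1..N k}" by blast
  from recommendation_best[OF this] show ?thesis by simp
qed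

text \<open>
  A removed cell could only become active again as a child of a cell selected later.  But every
  cell below the root enters through the selection of its parent, and the parent is unique because
  cells of equal depth are disjoint; so the parent would have been selected twice.  To run this
  inside the induction, the invariant records for every cell seen so far that its parent was
  selected.
\<close>

lemma parent_selected_and_act_fresh:
  "(\<forall>h j. (Suc h, j) \<in> act k \<union> sel ` {..<k} \<longrightarrow>
      (\<exists>l<k. hs l = h \<and> cell (Suc h) j \<subseteq> cell h (js l))) \<and>
   act k \<inter> sel ` {..<k} = {}"
proof (induction k)
  case 0
  then show ?case using act_0 by simp
next
  case (Suc k)
  then have parent: "\<And>h j. (Suc h, j) \<in> act k \<union> sel ` {..<k} \<Longrightarrow>
      \<exists>l<k. hs l = h \<and> cell (Suc h) j \<subseteq> cell h (js l)"
    and fresh: "act k \<inter> sel ` {..<k} = {}"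
    by blast+
  have "\<exists>l<Suc k. hs l = h \<and> cell (Suc h) j \<subseteq> cell h (js l)"
    if cell: "(Suc h, j) \<in> act (Suc k) \<union> sel ` {..<Suc k}" for h j
  proof -
    consider "(Suc h, j) \<in> act k \<union> sel ` {..<k}" | "j \<in> set (ord k)" "h = hs k"
      using cell sel_in_act[of k] unfolding act_Suc lessThan_Suc by auto
    then show ?thesis
    proof cases
      case 1
      from parent[OF this] show ?thesis using less_SucI by blast
    next
      case 2
      then show ?thesis using child_in_parent(3)[of j k] by blast
    qed
  qed
  moreover have "(Suc (hs k), j) \<notin> sel ` {..<k}" if j: "j \<in> set (ord k)" for j
  proof
    assume "(Suc (hs k), j) \<in> sel ` {..<k}"
    then obtain l where l: "l < k" "hs l = hs k" "cell (Suc (hs k)) j \<subseteq> cell (hs k) (js l)"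
      using parent[of "hs k" j] by blast
    have "cell (hs k) (js l) \<inter> cell (hs k) (js k) \<noteq> {}"
      using l(3) child_in_parent(3)[OF j] cell_nonempty[OF child_in_parent(1)[OF j]] by blast
    then have "js l = js k"
      using cell_unique[of "js l" "hs k" "js k"] sel_valid(1)[of l] sel_valid(1)[of k] l(2) by simp
    then have "sel l = sel k"
      using l(2) unfolding sel_def by simp
    moreover have "sel l \<in> sel ` {..<k}" using l(1) by simp
    ultimately show False using fresh sel_in_act[of k] by auto
  qed
  then have "act (Suc k) \<inter> sel ` {..<Suc k} = {}"
    using fresh unfolding act_Suc lessThan_Suc sel_def[symmetric] by auto
  ultimately show ?case by blast
qed

lemma inj_sel: "inj sel"
proof (rule linorder_injI)
  fix l k :: nat
  assume "l < k"
  then show "sel l \<noteq> sel k"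
    using parent_selected_and_act_fresh[of k] sel_in_act[of k] by (metis IntI emptyE imageI lessThan_iff)
qed

section \<open>Counting iterations\<close>

text \<open>
  A gap above \<open>a\<close> forces \<open>\<delta>^h > a / (L R)\<close> for each selected cell in question, hence also for the
  deeper one of any two, which is the depth that (D2) refers to.
\<close>

lemma count_in_layer:
  assumes "finite I" "0 < a" and layer: "\<And>l. l \<in> I \<Longrightarrow> rep (hs l) (js l) \<in> layer X f a b"
  shows "ereal (real K * real (card I)) \<le>
    ereal (doo_const CARD('d) K R \<nu>) * ereal_of_enat (packing_number nrm (layer X f a b) (a / L))"
proof -
  let ?r = "\<lambda>l. rep (hs l) (js l)"
  have a: "a / (L * R) < \<delta> ^ hs l" if "l \<in> I" for l
  proof -
    have "a < L * R * \<delta> ^ hs l"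
      using layer[OF that] sel_gap_le[of l] unfolding layer_def by simp
    then show ?thesis using L_pos R_pos by (simp add: pos_divide_less_eq mult.commute)
  qed
  have sep: "\<nu> * (a / L) / R < nrm (?r l - ?r l')" if l: "l \<in> I" "l' \<in> I" "l \<noteq> l'" for l l'
  proof -
    have "a / (L * R) < \<delta> ^ max (hs l) (hs l')"
      using a[OF l(1)] a[OF l(2)] by (simp add: max_def)
    then have "\<nu> * (a / (L * R)) < \<nu> * \<delta> ^ max (hs l) (hs l')"
      using \<nu>_pos by (intro mult_strict_left_mono)
    also have "\<dots> \<le> nrm (?r l - ?r l')"
      using injD[OF inj_sel, of l l'] l(3) unfolding sel_def
      by (intro rep_separation sel_valid(1)) blast
    finally show ?thesis by simp
  qed
  have "0 \<le> \<nu> * (a / L) / R"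
    using \<nu>_pos R_pos L_pos assms(2) by simp
  moreover have "nrm (0 :: real ^ 'd) = 0"
    using is_norm_eq_0_iff[OF nrm] by blast
  ultimately have "inj_on ?r I"
    using sep by (intro inj_onI) (metis diff_self not_less)
  then have "card (?r ` I) = card I"
    by (rule card_image)
  moreover have "ereal (real K * real (card (?r ` I))) \<le> ereal (doo_const CARD('d) K R \<nu>) *
      ereal_of_enat (packing_number nrm (layer X f a b) (a / L))"
  proof (rule card_separated_le_doo_const[OF nrm _ _ _ R_pos \<nu>_pos])
    show "finite (?r ` I)" using assms(1) by simp
    show "?r ` I \<subseteq> layer X f a b" using layer by blast
    show "0 < a / L" using assms(2) L_pos by simp
    fix u v assume "u \<in> ?r ` I" "v \<in> ?r ` I" "u \<noteq> v"
    then show "nrm (u - v) > \<nu> * (a / L) / R" using sep by blast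
  qed
  ultimately show ?thesis by simp
qed

lemma count_iterations:
  assumes "0 < \<epsilon>" and unsolved: "\<And>l. l < k \<Longrightarrow> \<epsilon> < gap (rep (hs l) (js l))"
  defines "e \<equiv> eps_level (eps0 nrm X L) \<epsilon>"
  shows "ereal (real K * real k) \<le> ereal (doo_const CARD('d) K R \<nu>) *
    (\<Sum>i = 1..num_levels (eps0 nrm X L) \<epsilon>.
      ereal_of_enat (packing_number nrm (layer X f (e i) (e (i - 1))) (e i / L)))"
proof (cases "k = 0")
  case True
  have "0 \<le> doo_const CARD('d) K R \<nu>"
    unfolding doo_const_def using R_pos \<nu>_pos by (intro mult_nonneg_nonneg add_nonneg_nonneg) simp_all
  then have "0 \<le> ereal (doo_const CARD('d) K R \<nu>)"
    by simp
  with True show ?thesis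
    by (simp only: of_nat_0 mult_zero_right zero_ereal_def[symmetric])
      (intro ereal_0_le_mult sum_nonneg, simp_all)
next
  case False
  let ?m = "num_levels (eps0 nrm X L) \<epsilon>"
  let ?P = "\<lambda>i. ereal_of_enat (packing_number nrm (layer X f (e i) (e (i - 1))) (e i / L))"
  let ?r = "\<lambda>l. rep (hs l) (js l)"
  have "\<exists>i. i \<in> {1..?m} \<and> e i < gap (?r l) \<and> gap (?r l) \<le> e (i - 1)" if "l < k" for l
    unfolding e_def
    by (rule eps_level_bracket[OF assms(1) unsolved[OF that] gap_le_eps0[OF sel_rep_in_X]]) blast
  then have "\<forall>l\<in>{..<k}. \<exists>i. i \<in> {1..?m} \<and> e i < gap (?r l) \<and> gap (?r l) \<le> e (i - 1)"
    by simp
  from bchoice[OF this] obtain lev where lev: "\<And>l. l < k \<Longrightarrow> lev l \<in> {1..?m}"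
    "\<And>l. l < k \<Longrightarrow> e (lev l) < gap (?r l)" "\<And>l. l < k \<Longrightarrow> gap (?r l) \<le> e (lev l - 1)"
    by auto
  let ?I = "\<lambda>i. {l \<in> {..<k}. lev l = i}"
  \<comment> \<open>iteration 0 is unsolved, so its gap witnesses \<open>0 < \<epsilon> < eps0\<close>\<close>
  have "0 < eps0 nrm X L"
    using unsolved[of 0] gap_le_eps0[OF sel_rep_in_X, of 0] False assms(1) by simp
  then have e_pos: "0 < e i" for i
    unfolding e_def using eps_level_pos assms(1) by blast
  have "k = (\<Sum>i = 1..?m. card (?I i))"
    using sum_fun_comp[of "{..<k}" "{1..?m}" lev "\<lambda>_. 1 :: nat"] lev(1)
    by (simp add: image_subset_iff)
  then have "real k = (\<Sum>i = 1..?m. real (card (?I i)))"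
    by (metis of_nat_sum)
  then have "ereal (real K * real k) = (\<Sum>i = 1..?m. ereal (real K * real (card (?I i))))"
    by (simp only: sum_ereal sum_distrib_left)
  also have "\<dots> \<le> (\<Sum>i = 1..?m. ereal (doo_const CARD('d) K R \<nu>) * ?P i)"
    using lev sel_rep_in_X by (intro sum_mono count_in_layer e_pos) (auto simp: layer_def)
  also have "\<dots> = ereal (doo_const CARD('d) K R \<nu>) * (\<Sum>i = 1..?m. ?P i)"
    by (rule sum_ereal_right_distrib[symmetric]) simp
  finally show ?thesis .
qed

text \<open>
  The bound is applied at the first iteration that starts with an \<open>\<epsilon>\<close>-optimal recommendation: all
  cells selected before it have gap above \<open>\<epsilon>\<close>, and at most \<open>K\<close> points were queried for each.  If
  no iteration ever starts so, the same count holds for arbitrarily many iterations, and the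
  right-hand side is infinite.
\<close>

lemma first_solved_query_le:
  assumes "0 < \<epsilon>"
  defines "e \<equiv> eps_level (eps0 nrm X L) \<epsilon>"
  shows "ereal_of_enat (INF n\<in>{n. 1 \<le> n \<and> gap (xr n) \<le> \<epsilon>}. enat n)
    \<le> 1 + ereal (doo_const CARD('d) K R \<nu>) *
      (\<Sum>i = 1..num_levels (eps0 nrm X L) \<epsilon>.
        ereal_of_enat (packing_number nrm (layer X f (e i) (e (i - 1))) (e i / L)))"
    (is "ereal_of_enat ?inf \<le> 1 + ?B")
proof (cases "\<exists>k. gap (xr (N k)) \<le> \<epsilon>")
  case True
  define k where "k = (LEAST k. gap (xr (N k)) \<le> \<epsilon>)"
  have k: "gap (xr (N k)) \<le> \<epsilon>"
    unfolding k_def using True by (rule LeastI_ex)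
  have "\<epsilon> < gap (rep (hs l) (js l))" if "l < k" for l
    using not_less_Least[of l "\<lambda>k. gap (xr (N k)) \<le> \<epsilon>"] that gap_recommendation_le_sel[of l l]
    unfolding k_def by simp
  then have bound: "ereal (real K * real k) \<le> ?B"
    unfolding e_def by (rule count_iterations[OF assms(1)])
  have queries_le: "ereal (real (N k)) \<le> 1 + ereal (real K * real k)"
  proof -
    have "real (N k) \<le> real (1 + K * k)"
      using N_le[of k] by (simp only: of_nat_le_iff)
    then show ?thesis by (simp add: one_ereal_def)
  qed
  have "?inf \<le> enat (N k)"
    using k N_pos[of k] by (intro INF_lower) simp
  then have "ereal_of_enat ?inf \<le> ereal_of_enat (enat (N k))"
    by (simp only: ereal_of_enat_le_iff)
  also have "\<dots> = ereal (real (N k))"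
    by simp
  also note queries_le
  also have "1 + ereal (real K * real k) \<le> 1 + ?B"
    by (rule add_left_mono[OF bound])
  finally show ?thesis .
next
  case False
  have large: "ereal (real K * real k) \<le> ?B" for k
  proof -
    have "\<epsilon> < gap (rep (hs l) (js l))" for l
    proof -
      have "\<epsilon> < gap (xr (N l))" using False by (simp add: not_le)
      with gap_recommendation_le_sel[of l l] show ?thesis by simp
    qed
    then show ?thesis unfolding e_def by (intro count_iterations[OF assms(1)])
  qed
  have K: "1 \<le> K" using hierarchy unfolding cell_hierarchy_def by simp
  have "?B = \<infinity>"
  proof (rule ereal_top)
    fix b :: real
    obtain k :: nat where "b \<le> real k" using real_arch_simple by blast
    also have "\<dots> \<le> real K * real k" using K by (simp add: mult_le_cancel_right1)
    finally have "ereal b \<le> ereal (real K * real k)" by simp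
    then show "ereal b \<le> ?B" using large[of k] by (rule order_trans)
  qed
  then have "1 + ?B = 1 + \<infinity>"
    by (rule arg_cong)
  also have "1 + \<infinity> = (\<infinity> :: ereal)"
    by simp
  finally show ?thesis
    by (simp only: ereal_less_eq)
qed

end

theorem proposition5:
  fixes nrm :: "real ^ 'd \<Rightarrow> real" and X :: "(real ^ 'd) set"
    and L \<delta> R \<nu> :: real and K :: nat
    and cell :: "nat \<Rightarrow> nat \<Rightarrow> (real ^ 'd) set" and rep :: "nat \<Rightarrow> nat \<Rightarrow> real ^ 'd"
    and A :: "'d algorithm"
  assumes "is_norm nrm"
    and "X \<noteq> {}" and "compact X"
    and "0 < L"
    and "cell_hierarchy X K cell rep"
    and "cond_D1 nrm K cell \<delta> R"
    and "cond_D2 nrm K rep \<delta> \<nu>"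
    and "is_nc_DOO nrm X L K cell rep \<delta> R A"
  shows "\<forall>f\<in>lip_class nrm X L. \<forall>\<epsilon>\<in>{0<..eps0 nrm X L}.
    ereal_of_enat (sample_complexity X A f \<epsilon>)
      \<le> 1 + ereal (doo_const CARD('d) K R \<nu>) *
          (\<Sum>k = 1..num_levels (eps0 nrm X L) \<epsilon>.
             ereal_of_enat (packing_number nrm
               (layer X f (eps_level (eps0 nrm X L) \<epsilon> k) (eps_level (eps0 nrm X L) \<epsilon> (k - 1)))
               (eps_level (eps0 nrm X L) \<epsilon> k / L)))"
proof (intro ballI)
  fix f \<epsilon>
  assume f: "f \<in> lip_class nrm X L" and \<epsilon>: "\<epsilon> \<in> {0<..eps0 nrm X L}"
  have run: "nc_DOO_run X L K cell rep \<delta> R f (\<lambda>n. fst (A f n)) (\<lambda>n. snd (A f n))"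
    using assms(8) f unfolding is_nc_DOO_def by blast
  show "ereal_of_enat (sample_complexity X A f \<epsilon>)
      \<le> 1 + ereal (doo_const CARD('d) K R \<nu>) *
          (\<Sum>k = 1..num_levels (eps0 nrm X L) \<epsilon>.
             ereal_of_enat (packing_number nrm
               (layer X f (eps_level (eps0 nrm X L) \<epsilon> k) (eps_level (eps0 nrm X L) \<epsilon> (k - 1)))
               (eps_level (eps0 nrm X L) \<epsilon> k / L)))"
    using run unfolding nc_DOO_run_def
  proof (elim exE conjE, goal_cases)
    case (1 act N hs js ord)
    interpret nc_doo_execution nrm X L \<delta> R \<nu> K cell rep f
      "\<lambda>n. fst (A f n)" "\<lambda>n. snd (A f n)" act N hs js ord
      by unfold_locales (use 1 assms f in simp_all)
    show ?case
      unfolding sample_complexity_def using first_solved_query_le \<epsilon> by simp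
  qed
qed

end
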